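(* Let $G=G_1\cup G_2$ be a connected graph, where $G_1,G_2$ are connected, edge-disjoint subgraphs with $G_1\cap G_2=\{p,q,s\}$ for three distinct vertices $p,q,s$ of $G$. Then $$t(G)=t(G_1)\,t(G_{2,pqs})+t(G_2)\,t(G_{1,pqs})+\frac12\Big[a_1(-a_2+b_2+c_2)+b_1(a_2-b_2+c_2)+c_1(a_2+b_2-c_2)\Big],$$ where $a_i=t(G_{i,ps})$, $b_i=t(G_{i,pq})$, $c_i=t(G_{i,qs})$ for $i\in\{1,2\}$. In particular, if $G_2$ is a copy of $G_1$ glued along the same three vertices $p,q,s$, then $t(G)=4\,t(G_1)\,t(G_{1,pqs})$.
   Context: Graphs are finite and may have multiple edges and loops; $t(H)$ is the number of spanning trees of $H$ (a one-vertex graph has $t=1$). $G_{i,xy}$ is obtained from $G_i$ by identifying vertices $x$ and $y$; $G_{i,pqs}$ is obtained from $G_i$ by identifying $p,q,s$ into a single vertex. *)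

theory Defs
  imports Complex_Main
begin

text \<open>A finite multigraph (loops and parallel edges allowed) is given by a vertex set V,
an edge set E and an endpoint map ends; an edge e joins fst (ends e) and snd (ends e).\<close>

definition is_mgraph :: "'v set \<Rightarrow> 'e set \<Rightarrow> ('e \<Rightarrow> 'v \<times> 'v) \<Rightarrow> bool" where
  "is_mgraph V E ends \<longleftrightarrow> finite V \<and> finite E \<and>
     (\<forall>e\<in>E. fst (ends e) \<in> V \<and> snd (ends e) \<in> V)"

definition adj_rel :: "('e \<Rightarrow> 'v \<times> 'v) \<Rightarrow> 'e set \<Rightarrow> ('v \<times> 'v) set" where
  "adj_rel ends T = {(x, y). \<exists>e\<in>T. ends e = (x, y) \<or> ends e = (y, x)}"

text \<open>The spanning subgraph (V, T) is connected.\<close>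
definition connected_sub :: "'v set \<Rightarrow> 'e set \<Rightarrow> ('e \<Rightarrow> 'v \<times> 'v) \<Rightarrow> bool" where
  "connected_sub V T ends \<longleftrightarrow> V \<noteq> {} \<and> (\<forall>x\<in>V. \<forall>y\<in>V. (x, y) \<in> (adj_rel ends T)\<^sup>*)"

text \<open>A spanning tree: a spanning subgraph that is a tree, i.e. minimally connected
(connected, and deleting any of its edges disconnects it).\<close>
definition spanning_tree :: "'v set \<Rightarrow> 'e set \<Rightarrow> ('e \<Rightarrow> 'v \<times> 'v) \<Rightarrow> 'e set \<Rightarrow> bool" where
  "spanning_tree V E ends T \<longleftrightarrow> T \<subseteq> E \<and> connected_sub V T ends \<and>
     (\<forall>e\<in>T. \<not> connected_sub V (T - {e}) ends)"

text \<open>t(H): number of spanning trees.\<close>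
definition num_st :: "'v set \<Rightarrow> 'e set \<Rightarrow> ('e \<Rightarrow> 'v \<times> 'v) \<Rightarrow> nat" where
  "num_st V E ends = card {T. spanning_tree V E ends T}"

text \<open>Identification of the vertices of a set S into the single vertex a (a \<in> S).\<close>
definition merge_to :: "'v set \<Rightarrow> 'v \<Rightarrow> 'v \<Rightarrow> 'v" where
  "merge_to S a v = (if v \<in> S then a else v)"

text \<open>t of the graph obtained from (V,E,ends) by identifying all vertices of S into one
(the representative is an element of S; the count does not depend on the choice).\<close>
definition num_st_ident :: "'v set \<Rightarrow> 'e set \<Rightarrow> ('e \<Rightarrow> 'v \<times> 'v) \<Rightarrow> 'v set \<Rightarrow> nat" where
  "num_st_ident V E ends S =
     (let a = (SOME a. a \<in> S); f = merge_to S a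
      in num_st (f ` V) E (\<lambda>e. map_prod f f (ends e)))"

end

theory Submission
  imports Defs
begin

text \<open>Call a forest \<open>S\<close>-rooted if each of its components contains exactly one vertex of \<open>S\<close>. Spanning
trees of the graph with \<open>S\<close> identified are exactly the \<open>S\<close>-rooted forests. If \<open>T\<^sub>1 \<union> T\<^sub>2\<close> is a spanning
tree of \<open>G\<close>, then \<open>T\<^sub>2\<close> partitions \<open>{p, q, s}\<close> in one of five ways, and the admissible \<open>T\<^sub>1\<close> are the
spanning trees of \<open>G\<^sub>1\<close> with the terminals identified accordingly. The two-component forests \<open>x\<^sub>p\<close>, \<open>x\<^sub>q\<close>,
\<open>x\<^sub>s\<close> that split off one terminal satisfy \<open>a = x\<^sub>p + x\<^sub>s\<close>, \<open>b = x\<^sub>p + x\<^sub>q\<close>, \<open>c = x\<^sub>q + x\<^sub>s\<close>, which gives the formula.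

For two equal halves one needs in addition \<open>t(G\<^sub>1) t(G\<^sub>1\<^sub>,\<^sub>p\<^sub>q\<^sub>s) = x\<^sub>p x\<^sub>q + x\<^sub>p x\<^sub>s + x\<^sub>q x\<^sub>s\<close>. By Kirchhoff, the number
of rooted forests joining \<open>v\<close> to \<open>p\<close> is an electric potential whose current through an edge is a signed
count of spanning forests, and the identity is Green's reciprocity for two such potentials.\<close>

section \<open>Connectivity, forests and rooted forests\<close>

definition conn :: "('e \<Rightarrow> 'v \<times> 'v) \<Rightarrow> 'e set \<Rightarrow> 'v \<Rightarrow> 'v \<Rightarrow> bool" where
  "conn g T u v \<longleftrightarrow> (u, v) \<in> (adj_rel g T)\<^sup>*"

text \<open>Acyclicity is encoded as every edge being a bridge, so cycles never have to be handled;
  loops are excluded because \<open>conn\<close> is reflexive.\<close>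

definition forest :: "('e \<Rightarrow> 'v \<times> 'v) \<Rightarrow> 'e set \<Rightarrow> bool" where
  "forest g T \<longleftrightarrow> (\<forall>e\<in>T. \<not> conn g (T - {e}) (fst (g e)) (snd (g e)))"

definition rooted :: "'v set \<Rightarrow> ('e \<Rightarrow> 'v \<times> 'v) \<Rightarrow> 'e set \<Rightarrow> 'v set \<Rightarrow> bool" where
  "rooted V g T S \<longleftrightarrow> (\<forall>v\<in>V. \<exists>r\<in>S. conn g T v r)"

definition separated :: "('e \<Rightarrow> 'v \<times> 'v) \<Rightarrow> 'e set \<Rightarrow> 'v set \<Rightarrow> bool" where
  "separated g T S \<longleftrightarrow> (\<forall>r\<in>S. \<forall>r'\<in>S. conn g T r r' \<longrightarrow> r = r')"

definition rooted_forests :: "'v set \<Rightarrow> 'e set \<Rightarrow> ('e \<Rightarrow> 'v \<times> 'v) \<Rightarrow> 'v set \<Rightarrow> 'e set set" where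
  "rooted_forests V E g S = {T. T \<subseteq> E \<and> forest g T \<and> rooted V g T S \<and> separated g T S}"

lemma conn_refl [simp]: "conn g T v v"
  by (simp add: conn_def)

lemma conn_trans: "conn g T u v \<Longrightarrow> conn g T v w \<Longrightarrow> conn g T u w"
  unfolding conn_def by (rule rtrancl_trans)

lemma conn_sym: "conn g T u v \<Longrightarrow> conn g T v u"
proof -
  assume "conn g T u v"
  moreover have "sym (adj_rel g T)"
    by (auto simp: sym_def adj_rel_def)
  ultimately show ?thesis
    unfolding conn_def by (meson sym_rtrancl symD)
qed

lemma conn_commute: "conn g T u v \<longleftrightarrow> conn g T v u"
  using conn_sym by metis

lemma conn_cong_left: "conn g T a b \<Longrightarrow> conn g T a v \<longleftrightarrow> conn g T b v"
  using conn_trans[of g T a b v] conn_trans[of g T b a v] conn_sym[of g T a b] by blast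

lemma conn_cong_right: "conn g T a b \<Longrightarrow> conn g T v a \<longleftrightarrow> conn g T v b"
  using conn_trans[of g T v a b] conn_trans[of g T v b a] conn_sym[of g T a b] by blast

lemma conn_mono: "conn g T u v \<Longrightarrow> T \<subseteq> T' \<Longrightarrow> conn g T' u v"
  unfolding conn_def
  by (rule subsetD[OF rtrancl_mono]) (auto simp: adj_rel_def)

lemma conn_edge: "e \<in> T \<Longrightarrow> g e = (x, y) \<or> g e = (y, x) \<Longrightarrow> conn g T x y"
  unfolding conn_def by (auto simp: adj_rel_def)

lemma conn_induct [consumes 1, case_names base step]:
  assumes "conn g T u v"
    and "P u"
    and "\<And>e x y. e \<in> T \<Longrightarrow> g e = (x, y) \<or> g e = (y, x) \<Longrightarrow> conn g T u x \<Longrightarrow> P x \<Longrightarrow> P y"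
  shows "P v"
  using assms(1) unfolding conn_def
proof (induction rule: rtrancl_induct)
  case base
  then show ?case by (rule assms(2))
next
  case (step x y)
  then obtain e where "e \<in> T" "g e = (x, y) \<or> g e = (y, x)"
    by (auto simp: adj_rel_def)
  with step show ?case
    using assms(3)[of e x y] by (simp add: conn_def)
qed

text \<open>A walk can be shortened to cross \<open>e\<close> at most once: whenever it crosses
  \<open>e\<close>, the case reached so far already connects \<open>u\<close> to an end of
  \<open>e\<close> inside \<open>F\<close>.\<close>

lemma conn_insert_cases:
  assumes "conn g T u v" "T \<subseteq> insert e F" "g e = (x, y) \<or> g e = (y, x)"
  shows "conn g F u v \<or> conn g F u x \<and> conn g F y v \<or> conn g F u y \<and> conn g F x v"
  using assms(1)
proof (induction rule: conn_induct)
  case base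
  then show ?case by simp
next
  case (step e' a b)
  show ?case
  proof (cases "e' = e")
    case True
    with step(2) assms(3) have "a = x \<and> b = y \<or> a = y \<and> b = x" by auto
    with step(4) show ?thesis using conn_refl by metis
  next
    case False
    with step(1) assms(2) have "e' \<in> F" by auto
    then have "conn g F a b" using step(2) by (rule conn_edge)
    with step(4) show ?thesis using conn_trans by metis
  qed
qed

lemma conn_remove_nonbridge:
  assumes "conn g (T - {e}) (fst (g e)) (snd (g e))" "conn g T u v"
  shows "conn g (T - {e}) u v"
proof -
  let ?F = "T - {e}" and ?x = "fst (g e)" and ?y = "snd (g e)"
  have "T \<subseteq> insert e ?F" by blast
  from conn_insert_cases[OF assms(2) this, of ?x ?y] consider "conn g ?F u v"
    | "conn g ?F u ?x" "conn g ?F ?y v" | "conn g ?F u ?y" "conn g ?F ?x v" by fastforce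
  then show ?thesis
  proof cases
    case 2
    then show ?thesis using conn_trans[OF conn_trans[OF _ assms(1)]] by blast
  next
    case 3
    then show ?thesis using conn_trans[OF conn_trans[OF _ conn_sym[OF assms(1)]]] by blast
  qed
qed

lemma forest_subset:
  assumes "forest g T" "T' \<subseteq> T"
  shows "forest g T'"
  unfolding forest_def
proof
  fix e assume "e \<in> T'"
  then have "e \<in> T" "T' - {e} \<subseteq> T - {e}" using assms(2) by auto
  then show "\<not> conn g (T' - {e}) (fst (g e)) (snd (g e))"
    using assms(1) conn_mono unfolding forest_def by metis
qed

section \<open>Signed incidence and separating edges in a forest\<close>

definition side :: "('e \<Rightarrow> 'v \<times> 'v) \<Rightarrow> 'e set \<Rightarrow> 'e \<Rightarrow> 'v \<Rightarrow> real" where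
  "side g T e v = of_bool (conn g (T - {e}) (fst (g e)) v)"

text \<open>\<open>side g T e a - side g T e b\<close> is the signed incidence of \<open>e\<close> with the path from \<open>a\<close> to \<open>b\<close> in \<open>T\<close>;
  being additive in \<open>(a, b)\<close>, it avoids explicit paths.\<close>
lemma forest_telescope:
  fixes \<phi> :: "'v \<Rightarrow> real"
  assumes "forest g T" "finite T" "conn g T a b"
  shows "(\<Sum>e\<in>T. (side g T e a - side g T e b) * (\<phi> (fst (g e)) - \<phi> (snd (g e)))) = \<phi> a - \<phi> b"
  using assms(3)
proof (induction rule: conn_induct)
  case base
  then show ?case by simp
next
  case (step e0 x y)
  \<comment> \<open>For \<open>e \<noteq> e0\<close> the edge \<open>e0\<close> survives in
    \<open>T - {e}\<close> and keeps \<open>x\<close> and \<open>y\<close> on the same side, so only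
    the term of \<open>e0\<close> changes.\<close>
  have other: "side g T e x = side g T e y" if "e \<noteq> e0" for e
  proof -
    have "conn g (T - {e}) x y" using step(1,2) that by (intro conn_edge[of e0]) auto
    from conn_cong_right[OF this] show ?thesis by (simp add: side_def)
  qed
  have bridge: "\<not> conn g (T - {e0}) (fst (g e0)) (snd (g e0))"
    using assms(1) step(1) by (simp add: forest_def)
  \<comment> \<open>As a bridge, \<open>e0\<close> has side value 1 at its first endpoint and 0 at
    its second; the sign records the direction of traversal.\<close>
  have "(side g T e0 x - side g T e0 y) * (\<phi> (fst (g e0)) - \<phi> (snd (g e0))) = \<phi> x - \<phi> y"
    using step(2) bridge by (auto simp: side_def)
  moreover have "(\<Sum>e\<in>T. (side g T e x - side g T e y) * (\<phi> (fst (g e)) - \<phi> (snd (g e))))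
     = (\<Sum>e\<in>{e0}. (side g T e x - side g T e y) * (\<phi> (fst (g e)) - \<phi> (snd (g e))))"
    using step(1) assms(2) other by (intro sum.mono_neutral_right) auto
  ultimately have "(\<Sum>e\<in>T. (side g T e x - side g T e y) * (\<phi> (fst (g e)) - \<phi> (snd (g e)))) = \<phi> x - \<phi> y"
    by simp
  with step(4) have "(\<Sum>e\<in>T. (side g T e a - side g T e x) * (\<phi> (fst (g e)) - \<phi> (snd (g e)))
      + (side g T e x - side g T e y) * (\<phi> (fst (g e)) - \<phi> (snd (g e)))) = \<phi> a - \<phi> y"
    by (simp add: sum.distrib)
  then show ?case by (simp add: algebra_simps)
qed

text \<open>Telescoping the indicator of \<open>a\<close> gives 1, so some edge has a nonzero
  coefficient: exactly one of \<open>a\<close> and \<open>b\<close> stays with its first endpoint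
  once it is deleted.\<close>

lemma forest_separating_edge:
  assumes "forest g T" "finite T" "conn g T a b" "a \<noteq> b"
  obtains e x y where "e \<in> T" "g e = (x, y) \<or> g e = (y, x)"
    "conn g (T - {e}) a x" "conn g (T - {e}) y b"
proof -
  have "(\<Sum>e\<in>T. (side g T e a - side g T e b) * (of_bool (fst (g e) = a) - of_bool (snd (g e) = a))) = (1::real)"
    using forest_telescope[OF assms(1-3), of "\<lambda>v. of_bool (v = a)"] assms(4) by simp
  then obtain e where e: "e \<in> T" "side g T e a \<noteq> side g T e b"
    by (metis (no_types, lifting) sum.neutral diff_self mult_zero_left zero_neq_one)
  let ?x = "fst (g e)" and ?y = "snd (g e)" and ?F = "T - {e}"
  have xor: "conn g ?F ?x a \<noteq> conn g ?F ?x b"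
    using e(2) by (auto simp: side_def)
  have split: "conn g ?F a b \<or> conn g ?F a ?x \<and> conn g ?F ?y b \<or> conn g ?F a ?y \<and> conn g ?F ?x b"
    using assms(3) by (rule conn_insert_cases[of _ T _ _ e]) auto
  have "\<not> conn g ?F a b" using xor conn_cong_right[of g ?F a b] by blast
  with split show thesis
    using that[of e ?x ?y] that[of e ?y ?x] e(1) by fastforce
qed

section \<open>Spanning trees of identified graphs as rooted forests\<close>

text \<open>A non-bridge can be deleted, and so can an edge separating two connected roots, since
  both sides keep a root. Conversely, if deleting \<open>e\<close> leaves every vertex rooted, both
  ends of \<open>e\<close> reach the same root, so \<open>e\<close> was not a bridge.\<close>

lemma minimal_rooted_iff:
  assumes "finite T" "\<And>e. e \<in> T \<Longrightarrow> fst (g e) \<in> V \<and> snd (g e) \<in> V"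
  shows "rooted V g T S \<and> (\<forall>e\<in>T. \<not> rooted V g (T - {e}) S)
    \<longleftrightarrow> forest g T \<and> rooted V g T S \<and> separated g T S"
proof (intro iffI conjI; (elim conjE)?)
  assume r: "rooted V g T S" and min: "\<forall>e\<in>T. \<not> rooted V g (T - {e}) S"
  show f: "forest g T"
    unfolding forest_def
  proof (intro ballI notI)
    fix e assume e: "e \<in> T" "conn g (T - {e}) (fst (g e)) (snd (g e))"
    then have "rooted V g (T - {e}) S"
      using r conn_remove_nonbridge[OF e(2)] unfolding rooted_def by blast
    with min e(1) show False by blast
  qed
  show "separated g T S"
    unfolding separated_def
  proof (intro ballI impI, rule ccontr)
    fix a b assume ab: "a \<in> S" "b \<in> S" "conn g T a b" "a \<noteq> b"
    from forest_separating_edge[OF f assms(1) ab(3,4)] obtain e x y where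
      e: "e \<in> T" "g e = (x, y) \<or> g e = (y, x)" "conn g (T - {e}) a x" "conn g (T - {e}) y b" .
    have "rooted V g (T - {e}) S"
      unfolding rooted_def
    proof
      fix v assume "v \<in> V"
      then obtain r where rr: "r \<in> S" "conn g T v r" using r unfolding rooted_def by blast
      have "T \<subseteq> insert e (T - {e})" by blast
      from conn_insert_cases[OF rr(2) this e(2)] consider "conn g (T - {e}) v r"
        | "conn g (T - {e}) v x" | "conn g (T - {e}) v y" by blast
      then show "\<exists>r\<in>S. conn g (T - {e}) v r"
      proof cases
        case 1
        then show ?thesis using rr(1) by blast
      next
        case 2
        then show ?thesis using ab(1) conn_trans[OF _ conn_sym[OF e(3)]] by blast
      next
        case 3
        then show ?thesis using ab(2) conn_trans[OF _ e(4)] by blast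
      qed
    qed
    with min e(1) show False by blast
  qed
next
  assume f: "forest g T" and s: "separated g T S"
  show "\<forall>e\<in>T. \<not> rooted V g (T - {e}) S"
  proof (intro ballI notI)
    fix e assume e: "e \<in> T" "rooted V g (T - {e}) S"
    then obtain a b where ab: "a \<in> S" "b \<in> S"
      "conn g (T - {e}) (fst (g e)) a" "conn g (T - {e}) (snd (g e)) b"
      using assms(2) unfolding rooted_def by blast
    then have a: "conn g T (fst (g e)) a" and b: "conn g T (snd (g e)) b"
      using conn_mono[of g "T - {e}" _ _ T] by blast+
    have "conn g T (fst (g e)) (snd (g e))" using e(1) by (rule conn_edge) simp
    then have "conn g T a b"
      using conn_trans[OF conn_sym[OF a]] conn_trans[OF _ b] by blast
    then have "a = b" using s ab(1,2) unfolding separated_def by blast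
    then have "conn g (T - {e}) (fst (g e)) (snd (g e))"
      using ab(3) conn_cong_right[OF ab(4)] by blast
    with f e(1) show False unfolding forest_def by blast
  qed
qed

lemma connected_sub_iff_rooted:
  assumes "p \<in> V"
  shows "connected_sub V T g \<longleftrightarrow> rooted V g T {p}"
proof
  assume "connected_sub V T g"
  with assms show "rooted V g T {p}"
    by (auto simp: connected_sub_def rooted_def conn_def)
next
  assume "rooted V g T {p}"
  then have *: "conn g T v p" if "v \<in> V" for v using that by (auto simp: rooted_def)
  have "conn g T x y" if "x \<in> V" "y \<in> V" for x y
    using conn_trans[OF *[OF that(1)] conn_sym[OF *[OF that(2)]]] .
  with assms show "connected_sub V T g"
    by (auto simp: connected_sub_def conn_def)
qed

text \<open>A path in the quotient lifts to a path in \<open>g\<close> except for jumps between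
  elements of \<open>S\<close>; so reaching the merged vertex amounts to reaching some element of
  \<open>S\<close>.\<close>

lemma connected_sub_merge_iff:
  assumes "a \<in> S" "S \<subseteq> V"
  defines "f \<equiv> merge_to S a"
  shows "connected_sub (f ` V) T (\<lambda>e. map_prod f f (g e)) \<longleftrightarrow> rooted V g T S"
proof -
  let ?g = "\<lambda>e. map_prod f f (g e)"
  have fS: "f v = a" if "v \<in> S" for v using that by (simp add: f_def merge_to_def)
  have f_eq: "w = y \<or> w \<in> S" if "f w = f y" for w y
    using that assms(1) by (auto simp: f_def merge_to_def split: if_splits)
  have "f a \<in> f ` V" using assms(1,2) by auto
  then have aV: "a \<in> f ` V" using fS assms(1) by simp
  have "rooted (f ` V) ?g T {a} \<longleftrightarrow> rooted V g T S"
  proof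
    assume L: "rooted (f ` V) ?g T {a}"
    show "rooted V g T S"
      unfolding rooted_def
    proof
      fix v assume "v \<in> V"
      then have "conn ?g T a (f v)"
        using L by (auto simp: rooted_def intro: conn_sym)
      \<comment> \<open>A vertex of the quotient may have several preimages, hence the quantifier
        over \<open>w\<close>. Two distinct preimages of the same vertex lie in \<open>S\<close>,
        and an element of \<open>S\<close> is its own root.\<close>
      then have "\<forall>w. f w = f v \<longrightarrow> (\<exists>r\<in>S. conn g T w r)"
      proof (induction rule: conn_induct)
        case base
        show ?case using f_eq fS assms(1) conn_refl by metis
      next
        case (step e x' y')
        then obtain x y where xy: "x' = f x" "y' = f y" "g e = (x, y) \<or> g e = (y, x)"
          by (cases "g e") auto
        have "conn g T x y" using step(1) xy(3) by (rule conn_edge)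
        moreover obtain r where "r \<in> S" "conn g T x r" using step(4) xy(1) by blast
        ultimately have "\<exists>r\<in>S. conn g T y r" using conn_cong_left[of g T x y] by blast
        then show ?case using f_eq[of _ y] xy(2) conn_refl by metis
      qed
      then show "\<exists>r\<in>S. conn g T v r" by blast
    qed
  next
    assume R: "rooted V g T S"
    have map: "conn ?g T (f u) (f v)" if "conn g T u v" for u v
      using that
    proof (induction rule: conn_induct)
      case base
      show ?case by simp
    next
      case (step e x y)
      then have "conn ?g T (f x) (f y)" by (intro conn_edge[of e]) auto
      with step(4) show ?case by (rule conn_trans)
    qed
    show "rooted (f ` V) ?g T {a}"
      unfolding rooted_def
    proof
      fix v' assume "v' \<in> f ` V"
      then obtain v r where "v' = f v" "r \<in> S" "conn g T v r"
        using R unfolding rooted_def by blast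
      then show "\<exists>r\<in>{a}. conn ?g T v' r" using map fS by force
    qed
  qed
  then show ?thesis using connected_sub_iff_rooted[OF aV] by metis
qed

lemma minimal_rooted_sets_eq:
  assumes "is_mgraph V E g"
  shows "{T. T \<subseteq> E \<and> rooted V g T S \<and> (\<forall>e\<in>T. \<not> rooted V g (T - {e}) S)} = rooted_forests V E g S"
proof -
  have "rooted V g T S \<and> (\<forall>e\<in>T. \<not> rooted V g (T - {e}) S)
      \<longleftrightarrow> forest g T \<and> rooted V g T S \<and> separated g T S" if "T \<subseteq> E" for T
    using assms that by (intro minimal_rooted_iff) (auto simp: is_mgraph_def intro: finite_subset)
  then show ?thesis unfolding rooted_forests_def by blast
qed

lemma num_st_eq:
  assumes "is_mgraph V E g" "p \<in> V"
  shows "num_st V E g = card (rooted_forests V E g {p})"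
  unfolding num_st_def spanning_tree_def connected_sub_iff_rooted[OF assms(2)]
    minimal_rooted_sets_eq[OF assms(1)] ..

lemma num_st_ident_eq:
  assumes "is_mgraph V E g" "S \<noteq> {}" "S \<subseteq> V"
  shows "num_st_ident V E g S = card (rooted_forests V E g S)"
proof -
  have "(SOME a. a \<in> S) \<in> S" using assms(2) by (simp add: some_in_eq)
  note merge = connected_sub_merge_iff[OF this assms(3)]
  show ?thesis
    unfolding num_st_ident_def Let_def num_st_def spanning_tree_def merge
      minimal_rooted_sets_eq[OF assms(1)] ..
qed

section \<open>Exchanging an edge between rooted forests\<close>

text \<open>If an old edge \<open>e'\<close> ceased to be a bridge, the connection avoiding it would
  pass through \<open>e\<close>; together with \<open>e'\<close> it would join \<open>x\<close> to
  \<open>y\<close> inside \<open>F\<close>.\<close>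

lemma forest_insert:
  assumes "forest g F" "g e = (x, y) \<or> g e = (y, x)" "\<not> conn g F x y"
  shows "forest g (insert e F)"
  unfolding forest_def
proof (intro ballI notI)
  fix e' assume e': "e' \<in> insert e F"
    and c: "conn g (insert e F - {e'}) (fst (g e')) (snd (g e'))"
  show False
  proof (cases "e' = e")
    case True
    then have "conn g F (fst (g e)) (snd (g e))" using c conn_mono[OF c, of F] by blast
    then show False using assms(2,3) conn_sym[of g F] by auto
  next
    case False
    let ?F = "F - {e'}" and ?x = "fst (g e')" and ?y = "snd (g e')"
    have e'F: "e' \<in> F" using e' False by simp
    have xy: "conn g F ?x ?y" using e'F by (rule conn_edge) simp
    have mono: "conn g ?F u v \<Longrightarrow> conn g F u v" for u v by (rule conn_mono) auto
    have "insert e F - {e'} \<subseteq> insert e ?F" by blast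
    from conn_insert_cases[OF c this assms(2)] consider "conn g ?F ?x ?y"
      | "conn g ?F ?x x" "conn g ?F y ?y" | "conn g ?F ?x y" "conn g ?F x ?y" by blast
    then show False
    proof cases
      case 1
      then show False using assms(1) e'F by (simp add: forest_def)
    next
      case 2
      have "conn g F x y"
        using conn_trans[OF conn_trans[OF conn_sym[OF mono[OF 2(1)]] xy] conn_sym[OF mono[OF 2(2)]]] .
      then show False using assms(3) by simp
    next
      case 3
      have "conn g F x y"
        using conn_trans[OF conn_trans[OF mono[OF 3(2)] conn_sym[OF xy]] mono[OF 3(1)]] .
      then show False using assms(3) by simp
    qed
  qed
qed

lemma forest_bridge:
  assumes "forest g T" "e \<in> T" "g e = (x, y) \<or> g e = (y, x)"
  shows "\<not> conn g (T - {e}) x y"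
  using assms conn_sym[of g "T - {e}" x y] by (auto simp: forest_def)

lemma rooted_forestsD:
  assumes "T \<in> rooted_forests V E g S"
  shows "T \<subseteq> E" "forest g T" "v \<in> V \<Longrightarrow> \<exists>r\<in>S. conn g T v r"
    "r \<in> S \<Longrightarrow> r' \<in> S \<Longrightarrow> conn g T r r' \<Longrightarrow> r = r'"
  using assms by (auto simp: rooted_forests_def rooted_def separated_def)

text \<open>Adding \<open>e\<close> hangs the component of \<open>p\<close> onto that of another
  root, so \<open>p\<close> loses its role as a root; deleting \<open>e\<close> is the inverse. This
  turns a potential drop across \<open>e\<close> into a count of \<open>S\<close>-rooted
  forests.\<close>

lemma card_forest_exchange:
  assumes e: "e \<in> E" "g e = (x, y) \<or> g e = (y, x)" and V: "p \<in> V" "x \<in> V" "y \<in> V" and p: "p \<notin> S"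
  shows "card {F \<in> rooted_forests V E g (insert p S). conn g F x p \<and> \<not> conn g F y p}
    = card {T \<in> rooted_forests V E g S. e \<in> T \<and> conn g (T - {e}) p x \<and> (\<exists>r\<in>S. conn g (T - {e}) y r)}"
    (is "card ?A = card ?B")
proof -
  have notin: "e \<notin> F" if "F \<in> ?A" for F
  proof
    assume "e \<in> F"
    then have "conn g F x y" using e(2) by (rule conn_edge)
    then show False using that conn_cong_left[of g F x y p] by blast
  qed
  have fwd: "insert e F \<in> ?B" if F: "F \<in> ?A" for F
  proof -
    let ?T = "insert e F"
    have rf: "F \<in> rooted_forests V E g (insert p S)" and xp: "conn g F x p" and yp: "\<not> conn g F y p"
      using F by auto
    note D = rooted_forestsD[OF rf]
    have mono: "conn g F u v \<Longrightarrow> conn g ?T u v" for u v by (rule conn_mono) auto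
    have edge: "conn g ?T x y" using e(2) by (intro conn_edge[of e]) auto
    have xy: "\<not> conn g F x y" using xp yp conn_cong_left[of g F x y p] by blast
    obtain r0 where r0: "r0 \<in> S" "conn g F y r0" using D(3)[OF V(3)] yp by blast
    have pr0: "conn g ?T p r0"
      using conn_trans[OF conn_trans[OF conn_sym[OF mono[OF xp]] edge] mono[OF r0(2)]] .
    have root: "\<exists>r\<in>S. conn g ?T v r" if v: "v \<in> V" for v
    proof -
      obtain r where r: "r \<in> insert p S" "conn g F v r" using D(3)[OF v] by blast
      show ?thesis
      proof (cases "r = p")
        case True
        then have "conn g ?T v r0" using conn_trans[OF mono[OF r(2)]] pr0 by blast
        then show ?thesis using r0(1) by blast
      next
        case False
        then show ?thesis using r mono by blast
      qed
    qed
    have px: "\<not> conn g F r x" if "r \<in> S" for r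
      using D(4)[of r p] that p conn_trans[OF _ xp, of r] by blast
    have sep: "r = r'" if r: "r \<in> S" "r' \<in> S" "conn g ?T r r'" for r r'
    proof -
      from conn_insert_cases[OF r(3) subset_refl e(2)] have "conn g F r r'"
        using px[OF r(1)] px[OF r(2)] conn_sym[of g F x r'] by blast
      then show ?thesis using D(4) r(1,2) by blast
    qed
    have "?T - {e} = F" using notin[OF F] by simp
    moreover have "?T \<in> rooted_forests V E g S"
      using D(1) e(1) forest_insert[OF D(2) e(2) xy] root sep
      by (auto simp: rooted_forests_def rooted_def separated_def)
    ultimately show ?thesis using conn_sym[OF xp] r0 by auto
  qed
  have bwd: "T - {e} \<in> ?A" if T: "T \<in> ?B" for T
  proof -
    let ?F = "T - {e}"
    have rf: "T \<in> rooted_forests V E g S" and eT: "e \<in> T" and px: "conn g ?F p x" using T by auto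
    obtain r0 where r0: "r0 \<in> S" "conn g ?F y r0" using T by auto
    note D = rooted_forestsD[OF rf]
    have mono: "conn g ?F u v \<Longrightarrow> conn g T u v" for u v by (rule conn_mono) auto
    have edge: "conn g T x y" using eT e(2) by (rule conn_edge)
    have xy: "\<not> conn g ?F x y" by (rule forest_bridge[OF D(2) eT e(2)])
    have TF: "T \<subseteq> insert e ?F" by blast
    have root: "\<exists>r\<in>insert p S. conn g ?F v r" if v: "v \<in> V" for v
    proof -
      obtain r where r: "r \<in> S" "conn g T v r" using D(3)[OF v] by blast
      from conn_insert_cases[OF r(2) TF e(2)] show ?thesis
        using r(1) r0(1) conn_trans[OF _ conn_sym[OF px], of v] conn_trans[OF _ r0(2), of v] by blast
    qed
    \<comment> \<open>If \<open>p\<close> reached \<open>r\<close> without \<open>e\<close>, then so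
      would \<open>x\<close>, and crossing \<open>e\<close> to \<open>y\<close> would lead on to
      \<open>r0\<close>; hence \<open>r = r0\<close>, and \<open>x\<close> and \<open>y\<close>
      would be joined without \<open>e\<close>.\<close>
    have notp: "\<not> conn g ?F p r" if "r \<in> S" for r
    proof
      assume pr: "conn g ?F p r"
      have xr: "conn g ?F x r" using conn_trans[OF conn_sym[OF px] pr] .
      have "conn g T r r0" 
        using conn_trans[OF conn_trans[OF conn_sym[OF mono[OF xr]] edge] mono[OF r0(2)]] .
      then have "r = r0" using D(4) that r0(1) by blast
      then show False using conn_trans[OF xr] conn_sym[OF r0(2)] xy by blast
    qed
    have sep: "r = r'" if "r \<in> insert p S" "r' \<in> insert p S" "conn g ?F r r'" for r r'
      using that notp D(4) mono conn_sym[OF that(3)] by blast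
    have "\<not> conn g ?F y p" 
      using xy conn_sym[OF px] conn_sym[of g ?F y p] conn_trans[of g ?F x p y] by blast
    moreover have "?F \<in> rooted_forests V E g (insert p S)"
      using D(1) forest_subset[OF D(2), of ?F] root sep
      unfolding rooted_forests_def rooted_def separated_def by blast
    ultimately show ?thesis using conn_sym[OF px] by simp
  qed
  have "bij_betw (insert e) ?A ?B"
  proof (rule bij_betw_byWitness[where f' = "\<lambda>T. T - {e}"])
    show "\<forall>F\<in>?A. insert e F - {e} = F" using notin by blast
    show "\<forall>T\<in>?B. insert e (T - {e}) = T" by blast
    show "insert e ` ?A \<subseteq> ?B" using fwd by blast
    show "(\<lambda>T. T - {e}) ` ?B \<subseteq> ?A" using bwd by blast
  qed
  then show ?thesis by (rule bij_betw_same_card)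
qed

section \<open>Electric potentials and the Green identity\<close>

text \<open>For \<open>p \<notin> S\<close> and unit resistances this is the voltage at
  \<open>v\<close> with \<open>S\<close> grounded, scaled so that the current entering at
  \<open>p\<close> is the number of \<open>S\<close>-rooted forests.\<close>

definition potential :: "'v set \<Rightarrow> 'e set \<Rightarrow> ('e \<Rightarrow> 'v \<times> 'v) \<Rightarrow> 'v set \<Rightarrow> 'v \<Rightarrow> 'v \<Rightarrow> real" where
  "potential V E g S p v = real (card {F \<in> rooted_forests V E g (insert p S). conn g F v p})"

definition root_of :: "('e \<Rightarrow> 'v \<times> 'v) \<Rightarrow> 'v set \<Rightarrow> 'e set \<Rightarrow> 'v \<Rightarrow> 'v" where
  "root_of g S T v = (SOME r. r \<in> S \<and> conn g T v r)"

lemma root_of: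
  assumes "T \<in> rooted_forests V E g S" "v \<in> V"
  shows "root_of g S T v \<in> S" "conn g T v (root_of g S T v)"
proof -
  obtain r where "r \<in> S \<and> conn g T v r" using rooted_forestsD(3)[OF assms] by blast
  from someI[of "\<lambda>r. r \<in> S \<and> conn g T v r", OF this]
  show "root_of g S T v \<in> S" "conn g T v (root_of g S T v)" by (auto simp: root_of_def)
qed

lemma root_of_eq:
  assumes "T \<in> rooted_forests V E g S" "v \<in> V" "r \<in> S" "conn g T v r"
  shows "root_of g S T v = r"
  using rooted_forestsD(4)[OF assms(1) root_of(1)[OF assms(1,2)] assms(3)]
    conn_trans[OF conn_sym[OF root_of(2)[OF assms(1,2)]] assms(4)] by blast

lemma finite_rooted_forests: "finite E \<Longrightarrow> finite (rooted_forests V E g S)"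
  unfolding rooted_forests_def by simp

lemma card_Collect_eq_sum:
  "finite A \<Longrightarrow> real (card {x \<in> A. P x}) = (\<Sum>x\<in>A. of_bool (P x))"
  by (simp add: sum_of_bool_eq Int_def)

text \<open>Forests with both \<open>x\<close> and \<open>y\<close> in the component of
  \<open>p\<close> cancel. The edge exchange turns the others into \<open>S\<close>-rooted forests
  whose path from \<open>p\<close> to its root crosses \<open>e\<close>, with sign according to the
  direction.\<close>

lemma potential_diff:
  assumes "finite E" and e: "e \<in> E" "g e = (x, y)" and V: "p \<in> V" "x \<in> V" "y \<in> V" and p: "p \<notin> S"
  shows "potential V E g S p x - potential V E g S p y
    = (\<Sum>T\<in>rooted_forests V E g S. if e \<in> T then side g T e p - side g T e (root_of g S T p) else 0)"
proof -
  let ?N = "rooted_forests V E g (insert p S)" and ?M = "rooted_forests V E g S"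
  let ?A = "\<lambda>x y. {F \<in> ?N. conn g F x p \<and> \<not> conn g F y p}"
  let ?P = "\<lambda>x y T. e \<in> T \<and> conn g (T - {e}) p x \<and> (\<exists>r\<in>S. conn g (T - {e}) y r)"
  have fin: "finite ?N" "finite ?M" using assms(1) by (rule finite_rooted_forests)+
  have split: "card {F \<in> ?N. conn g F x p}
      = card (?A x y) + card {F \<in> ?N. conn g F x p \<and> conn g F y p}" for x y
  proof -
    have "{F \<in> ?N. conn g F x p} = ?A x y \<union> {F \<in> ?N. conn g F x p \<and> conn g F y p}" by blast
    then show ?thesis using fin(1) by (simp add: card_Un_disjoint disjoint_iff)
  qed
  have both: "{F \<in> ?N. conn g F x p \<and> conn g F y p} = {F \<in> ?N. conn g F y p \<and> conn g F x p}" by blast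
  have "potential V E g S p x - potential V E g S p y = real (card (?A x y)) - real (card (?A y x))"
    unfolding potential_def split[of x y] split[of y x] both by simp
  also have "\<dots> = real (card {T \<in> ?M. ?P x y T}) - real (card {T \<in> ?M. ?P y x T})"
    using card_forest_exchange[of e E g x y p V S] card_forest_exchange[of e E g y x p V S] e V p
    by simp
  also have "\<dots> = (\<Sum>T\<in>?M. of_bool (?P x y T) - of_bool (?P y x T))"
    unfolding card_Collect_eq_sum[OF fin(2)] sum_subtractf ..
  also have "\<dots> = (\<Sum>T\<in>?M. if e \<in> T then side g T e p - side g T e (root_of g S T p) else 0)"
  proof (rule sum.cong[OF refl])
    fix T assume T: "T \<in> ?M"
    note D = rooted_forestsD[OF T]
    let ?r = "root_of g S T p" and ?F = "T - {e}"
    have r: "?r \<in> S" "conn g T p ?r" using root_of[OF T V(1)] by auto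
    show "of_bool (?P x y T) - of_bool (?P y x T)
        = (if e \<in> T then side g T e p - side g T e ?r else 0)"
    proof (cases "e \<in> T")
      case eT: True
      have mono: "conn g ?F u v \<Longrightarrow> conn g T u v" for u v by (rule conn_mono) auto
      have xy: "\<not> conn g ?F x y" using D(2) eT e(2) by (intro forest_bridge) auto
      have TF: "T \<subseteq> insert e ?F" by blast
      have side: "side g T e v = of_bool (conn g ?F v x)" for v
        using e(2) conn_commute[of g ?F x v] by (simp add: side_def)
      from conn_insert_cases[OF r(2) TF, of x y] e(2) consider "conn g ?F p ?r"
        | "conn g ?F p x" "conn g ?F y ?r" | "conn g ?F p y" "conn g ?F x ?r" by blast
      then show ?thesis
      proof cases
        case 1
        \<comment> \<open>With \<open>e\<close> off the path from \<open>p\<close> to its root, a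
          root reached through \<open>e\<close> would be the same one, so \<open>e\<close> would not
          be a bridge; both indicators vanish.\<close>
        have no: "\<not> (conn g ?F p a \<and> (\<exists>r\<in>S. conn g ?F b r))"
          if ab: "g e = (a, b) \<or> g e = (b, a)" for a b
        proof
          assume "conn g ?F p a \<and> (\<exists>r\<in>S. conn g ?F b r)"
          then obtain r' where r': "conn g ?F p a" "r' \<in> S" "conn g ?F b r'" by blast
          have "conn g T a b" using eT ab by (rule conn_edge)
          then have "conn g T p r'"
            using conn_trans[OF conn_trans[OF mono[OF r'(1)]] mono[OF r'(3)]] by blast
          then have "r' = ?r" using root_of_eq[OF T V(1) r'(2)] by simp
          then have "conn g ?F a b"
            using conn_trans[OF conn_trans[OF conn_sym[OF r'(1)] 1]] conn_sym[OF r'(3)] by simp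
          then show False using forest_bridge[OF D(2) eT ab] by blast
        qed
        show ?thesis
          using no[of x y] no[of y x] e(2) conn_cong_left[OF 1, of x] by (auto simp: side)
      next
        case 2
        have "\<not> conn g ?F ?r x"
          using xy conn_trans[OF 2(2)] conn_sym[of g ?F y x] by blast
        moreover have "\<not> conn g ?F p y" 
          using xy conn_trans[OF conn_sym[OF 2(1)]] by blast
        ultimately show ?thesis using 2 r(1) eT by (auto simp: side)
      next
        case 3
        have "\<not> conn g ?F p x"
          using xy conn_trans[OF conn_sym[OF 3(1)]] conn_sym[of g ?F y x] by blast
        then show ?thesis using 3 conn_sym[OF 3(2)] r(1) eT by (auto simp: side)
      qed
    qed simp
  qed
  finally show ?thesis .
qed

text \<open>Insert the forest expression for the current, exchange the sums over edges and forests,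
  and telescope within each forest. With another potential as \<open>\<phi>\<close>, the symmetry of
  the left side gives reciprocity.\<close>

lemma green_identity:
  fixes \<phi> :: "'v \<Rightarrow> real"
  assumes G: "is_mgraph V E g" and p: "p \<in> V" "p \<notin> S"
  shows "(\<Sum>e\<in>E. (potential V E g S p (fst (g e)) - potential V E g S p (snd (g e)))
                  * (\<phi> (fst (g e)) - \<phi> (snd (g e))))
    = (\<Sum>T\<in>rooted_forests V E g S. \<phi> p - \<phi> (root_of g S T p))"
proof -
  let ?M = "rooted_forests V E g S"
  let ?d = "\<lambda>e. \<phi> (fst (g e)) - \<phi> (snd (g e))"
  let ?c = "\<lambda>T e. side g T e p - side g T e (root_of g S T p)"
  have fin: "finite E" using G by (simp add: is_mgraph_def)
  have "(\<Sum>e\<in>E. (potential V E g S p (fst (g e)) - potential V E g S p (snd (g e))) * ?d e)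
      = (\<Sum>e\<in>E. \<Sum>T\<in>?M. (if e \<in> T then ?c T e else 0) * ?d e)"
  proof (rule sum.cong[OF refl])
    fix e assume e: "e \<in> E"
    have "potential V E g S p (fst (g e)) - potential V E g S p (snd (g e))
        = (\<Sum>T\<in>?M. if e \<in> T then ?c T e else 0)"
      using G e p by (intro potential_diff fin) (auto simp: is_mgraph_def)
    then show "(potential V E g S p (fst (g e)) - potential V E g S p (snd (g e))) * ?d e
        = (\<Sum>T\<in>?M. (if e \<in> T then ?c T e else 0) * ?d e)"
      by (simp add: sum_distrib_right)
  qed
  also have "\<dots> = (\<Sum>T\<in>?M. \<Sum>e\<in>E. (if e \<in> T then ?c T e else 0) * ?d e)"
    by (rule sum.swap)
  also have "\<dots> = (\<Sum>T\<in>?M. \<phi> p - \<phi> (root_of g S T p))"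
  proof (rule sum.cong[OF refl])
    fix T assume T: "T \<in> ?M"
    note D = rooted_forestsD[OF T]
    have "(\<Sum>e\<in>E. (if e \<in> T then ?c T e else 0) * ?d e) = (\<Sum>e\<in>T. ?c T e * ?d e)"
      using D(1) fin by (intro sum.mono_neutral_cong_right) auto
    also have "\<dots> = \<phi> p - \<phi> (root_of g S T p)"
      using forest_telescope[OF D(2) finite_subset[OF D(1) fin] root_of(2)[OF T p(1)]] .
    finally show "(\<Sum>e\<in>E. (if e \<in> T then ?c T e else 0) * ?d e) = \<phi> p - \<phi> (root_of g S T p)" .
  qed
  finally show ?thesis .
qed

section \<open>Forests separating three terminals\<close>

definition split_forests :: "'v set \<Rightarrow> 'e set \<Rightarrow> ('e \<Rightarrow> 'v \<times> 'v) \<Rightarrow> 'v \<Rightarrow> 'v \<Rightarrow> 'v \<Rightarrow> 'e set set" where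
  "split_forests V E g a b c =
     {T. T \<subseteq> E \<and> forest g T \<and> rooted V g T {a, c} \<and> conn g T a b \<and> \<not> conn g T a c}"

lemma split_forests_commute: "split_forests V E g a b c = split_forests V E g b a c"
proof -
  have "rooted V g T {a, c} \<and> conn g T a b \<and> \<not> conn g T a c
      \<longleftrightarrow> rooted V g T {b, c} \<and> conn g T b a \<and> \<not> conn g T b c" for T
    using conn_cong_left[of g T a b c] conn_cong_right[of g T a b] conn_commute[of g T a b]
    by (auto simp: rooted_def)
  then show ?thesis unfolding split_forests_def by blast
qed

lemma split_forests_eq:
  assumes "a \<noteq> c"
  shows "split_forests V E g a b c = {T \<in> rooted_forests V E g {a, c}. conn g T b a}"
proof -
  have "separated g T {a, c} \<longleftrightarrow> \<not> conn g T a c" for T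
    using assms conn_commute[of g T a c] by (auto simp: separated_def)
  then show ?thesis
    unfolding split_forests_def rooted_forests_def using conn_commute[of g _ a b] by blast
qed

text \<open>The third terminal joins exactly one of the two roots; this yields the linear relations
  between pair identifications and split counts.\<close>

lemma card_rooted_forests_pair:
  assumes "finite E" "a \<noteq> c" "b \<in> V"
  shows "card (rooted_forests V E g {a, c})
    = card (split_forests V E g a b c) + card (split_forests V E g c b a)"
proof -
  have "rooted_forests V E g {a, c} = split_forests V E g a b c \<union> split_forests V E g c b a"
    using rooted_forestsD(3)[OF _ assms(3)] assms(2)
    by (fastforce simp: split_forests_eq split_forests_eq[of c a] insert_commute)
  moreover have "split_forests V E g a b c \<inter> split_forests V E g c b a = {}"
    using conn_trans[of g _ a b c] conn_sym[of g _ c b] unfolding split_forests_def by blast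
  moreover have "finite (split_forests V E g x b y)" for x y
    using assms(1) unfolding split_forests_def by simp
  ultimately show ?thesis by (simp add: card_Un_disjoint)
qed

text \<open>Evaluate the Dirichlet form of the potentials grounded at \<open>{s}\<close> and at \<open>{q, s}\<close> in both orders.\<close>
lemma three_terminal_identity:
  assumes G: "is_mgraph V E g" and V: "p \<in> V" "q \<in> V" "s \<in> V"
    and dist: "p \<noteq> q" "p \<noteq> s" "q \<noteq> s"
  defines "xp \<equiv> real (card (split_forests V E g q s p))"
    and "xq \<equiv> real (card (split_forests V E g p s q))"
    and "xs \<equiv> real (card (split_forests V E g p q s))"
  shows "real (card (rooted_forests V E g {s})) * real (card (rooted_forests V E g {p, q, s}))
    = xp * xq + xp * xs + xq * xs"
proof -
  let ?u = "potential V E g {s} p" and ?w = "potential V E g {q, s} p"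
  have fin: "finite E" using G by (simp add: is_mgraph_def)
  have up: "?u p = xp + xs"
  proof -
    have "?u p = card (rooted_forests V E g {p, s})" by (simp add: potential_def)
    then show ?thesis
      using card_rooted_forests_pair[OF fin dist(2) V(2)] split_forests_commute[of V E g s q p]
      by (simp add: xp_def xs_def)
  qed
  have uq: "?u q = xs"
    by (simp add: potential_def xs_def split_forests_eq[OF dist(2)])
  have zero: "potential V E g S p r = 0" if "r \<in> S" "p \<notin> S" for r S
  proof -
    have empty: "{F \<in> rooted_forests V E g (insert p S). conn g F r p} = {}"
      using that rooted_forestsD(4)[of _ V E g "insert p S" r p] by blast
    show ?thesis unfolding potential_def empty by simp
  qed
  have c: "real (card (rooted_forests V E g {q, s})) = xq + xs"
    using card_rooted_forests_pair[OF fin dist(3) V(1)] 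
      split_forests_commute[of V E g s p q] split_forests_commute[of V E g q p s]
    by (simp add: xq_def xs_def)
  have "(\<Sum>T\<in>rooted_forests V E g {s}. ?w p - ?w (root_of g {s} T p))
      = (\<Sum>T\<in>rooted_forests V E g {s}. real (card (rooted_forests V E g {p, q, s})))"
  proof (rule sum.cong[OF refl])
    fix T assume "T \<in> rooted_forests V E g {s}"
    then have "root_of g {s} T p = s" using root_of(1) V(1) by fastforce
    then show "?w p - ?w (root_of g {s} T p) = real (card (rooted_forests V E g {p, q, s}))"
      using zero[of s "{q, s}"] dist by (simp add: potential_def)
  qed
  then have "real (card (rooted_forests V E g {s})) * real (card (rooted_forests V E g {p, q, s}))
      = (\<Sum>T\<in>rooted_forests V E g {s}. ?w p - ?w (root_of g {s} T p))" by simp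
  also have "\<dots> = (\<Sum>e\<in>E. (?u (fst (g e)) - ?u (snd (g e))) * (?w (fst (g e)) - ?w (snd (g e))))"
    using green_identity[OF G V(1), of "{s}" ?w] dist by simp
  \<comment> \<open>The same symmetric sum over edges, now read with \<open>?w\<close> as the
    potential and \<open>?u\<close> as the test function.\<close>
  also have "\<dots> = (\<Sum>T\<in>rooted_forests V E g {q, s}. ?u p - ?u (root_of g {q, s} T p))"
    using green_identity[OF G V(1), of "{q, s}" ?u] dist by (simp add: mult.commute)
  also have "\<dots> = (\<Sum>T\<in>rooted_forests V E g {q, s}. xp + xs - xs * of_bool (conn g T p q))"
  \<comment> \<open>The root of \<open>p\<close> is \<open>q\<close>, where \<open>?u\<close> equals
    \<open>xs\<close>, or \<open>s\<close>, where it vanishes.\<close>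
  proof (rule sum.cong[OF refl])
    fix T assume T: "T \<in> rooted_forests V E g {q, s}"
    show "?u p - ?u (root_of g {q, s} T p) = xp + xs - xs * of_bool (conn g T p q)"
    proof (cases "conn g T p q")
      case True
      then have "root_of g {q, s} T p = q" by (intro root_of_eq[OF T V(1)]) auto
      then show ?thesis using True by (simp add: up uq)
    next
      case False
      then have "root_of g {q, s} T p = s" using root_of[OF T V(1)] by auto
      then show ?thesis using False zero[of s "{s}"] dist by (simp add: up)
    qed
  qed
  also have "\<dots> = (xp + xs) * (xq + xs) - xs * (\<Sum>T\<in>rooted_forests V E g {q, s}. of_bool (conn g T p q))"
    by (simp add: sum_subtractf sum_distrib_left c mult.commute)
  \<comment> \<open>The forests joining \<open>p\<close> to \<open>q\<close> are those splitting off
    \<open>s\<close>, so the total is \<open>(xp + xs) * (xq + xs) - xs * xs\<close>.\<close>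
  also have "(\<Sum>T\<in>rooted_forests V E g {q, s}. of_bool (conn g T p q)) = xs"
    unfolding xs_def split_forests_commute[of V E g p q s] split_forests_eq[OF dist(3)]
      card_Collect_eq_sum[OF finite_rooted_forests[OF fin]] ..
  finally show ?thesis by (simp add: algebra_simps)
qed

section \<open>Spanning trees of a graph glued along terminals\<close>

lemma rooted_forests_singleton:
  assumes "p \<in> V" "q \<in> V"
  shows "rooted_forests V E g {p} = rooted_forests V E g {q}"
  unfolding rooted_forests_def connected_sub_iff_rooted[OF assms(1), symmetric]
    connected_sub_iff_rooted[OF assms(2), symmetric]
  by (simp add: separated_def)

text \<open>In a glued graph, \<open>T\<^sub>2\<close> acts on \<open>T\<^sub>1\<close> like the identification of the terminals it connects;
  \<open>S\<close> is the only class of terminals that may have more than one element.\<close>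
locale gluing =
  fixes V1 V2 P S :: "'v set" and E1 E2 T2 :: "'e set" and g :: "'e \<Rightarrow> 'v \<times> 'v"
  assumes G1: "is_mgraph V1 E1 g" and G2: "is_mgraph V2 E2 g"
    and disj: "E1 \<inter> E2 = {}" and P: "V1 \<inter> V2 = P"
    and T2: "T2 \<subseteq> E2" "forest g T2" "rooted V2 g T2 P"
    and S: "S \<subseteq> P" "\<And>a b. a \<in> S \<Longrightarrow> b \<in> S \<Longrightarrow> conn g T2 a b"
    and classes: "\<And>a b. a \<in> P \<Longrightarrow> b \<in> P \<Longrightarrow> conn g T2 a b \<Longrightarrow> a = b \<or> a \<in> S \<and> b \<in> S"
begin

lemma ends1: "e \<in> E1 \<Longrightarrow> g e = (x, y) \<or> g e = (y, x) \<Longrightarrow> x \<in> V1 \<and> y \<in> V1"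
  using G1 by (fastforce simp: is_mgraph_def)

lemma ends2: "e \<in> E2 \<Longrightarrow> g e = (x, y) \<or> g e = (y, x) \<Longrightarrow> x \<in> V2 \<and> y \<in> V2"
  using G2 by (fastforce simp: is_mgraph_def)

text \<open>A path in the union that runs through \<open>T2\<close> between two distinct terminals
  joins elements of \<open>S\<close>, so in \<open>T1\<close> it can be replaced by a change of
  root. Conversely, \<open>T2\<close> connects all of \<open>S\<close> and leads every vertex of
  \<open>V2\<close> to a terminal.\<close>

lemma rooted_Un_iff:
  assumes T1: "T1 \<subseteq> E1" and r0: "r0 \<in> S"
  shows "rooted (V1 \<union> V2) g (T1 \<union> T2) {r0} \<longleftrightarrow> rooted V1 g T1 S"
proof
  assume L: "rooted (V1 \<union> V2) g (T1 \<union> T2) {r0}"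
  let ?R = "\<lambda>w. \<exists>r\<in>S. conn g T1 w r"
  show "rooted V1 g T1 S"
    unfolding rooted_def
  proof
    fix v assume v: "v \<in> V1"
    then have "conn g (T1 \<union> T2) r0 v" using L by (auto simp: rooted_def intro: conn_sym)
    \<comment> \<open>Inside \<open>V2\<close> the invariant remembers a terminal reachable in
      \<open>T2\<close> that is rooted in \<open>T1\<close>, so that rootedness is available when
      the path returns to \<open>V1\<close>.\<close>
    then have "(v \<in> V1 \<longrightarrow> ?R v) \<and> (v \<in> V2 \<longrightarrow> (\<exists>a\<in>P. conn g T2 v a \<and> ?R a))"
    proof (induction rule: conn_induct)
      case base
      have "?R r0" using r0 conn_refl[of g T1 r0] by blast
      then show ?case using r0 S(1) conn_refl[of g T2 r0] by blast
    next
      case (step e x y)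
      show ?case
      proof (cases "e \<in> T1")
        case True
        then have V: "x \<in> V1" "y \<in> V1" using ends1[OF _ step(2)] T1 by blast+
        have "conn g T1 x y" using True step(2) by (rule conn_edge)
        from conn_cong_left[OF this] have "?R y" using step(4) V(1) by blast
        then show ?thesis using V(2) P conn_refl[of g T2 y] by blast
      next
        case False
        then have eT: "e \<in> T2" using step(1) by blast
        then have V: "x \<in> V2" "y \<in> V2" using ends2[OF _ step(2)] T2(1) by blast+
        have xy: "conn g T2 x y" using eT step(2) by (rule conn_edge)
        obtain a where a: "a \<in> P" "conn g T2 x a" "?R a" using step(4) V(1) by blast
        have ya: "conn g T2 y a" using a(2) conn_cong_left[OF xy] by blast
        \<comment> \<open>A terminal \<open>y\<close> is either \<open>a\<close> itself, rooted by
          the invariant, or an element of \<open>S\<close> and thus its own root.\<close>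
        have "?R y" if "y \<in> V1"
          using classes[OF _ a(1) ya] that V(2) P a(3) conn_refl[of g T1 y] by blast
        then show ?thesis using a(1,3) ya by blast
      qed
    qed
    then show "?R v" using v by blast
  qed
next
  assume R: "rooted V1 g T1 S"
  have v1: "conn g (T1 \<union> T2) v r0" if v: "v \<in> V1" for v
  proof -
    obtain r where r: "r \<in> S" "conn g T1 v r" using R v unfolding rooted_def by blast
    show ?thesis
      using conn_trans[OF conn_mono[OF r(2) Un_upper1] conn_mono[OF S(2)[OF r(1) r0] Un_upper2]] .
  qed
  moreover have "conn g (T1 \<union> T2) v r0" if v: "v \<in> V2" for v
  proof -
    obtain a where a: "a \<in> P" "conn g T2 v a" using T2(3) v unfolding rooted_def by blast
    have "a \<in> V1" using a(1) P by blast
    from conn_trans[OF conn_mono[OF a(2) Un_upper2] v1[OF this]] show ?thesis .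
  qed
  ultimately show "rooted (V1 \<union> V2) g (T1 \<union> T2) {r0}" unfolding rooted_def by blast
qed

text \<open>An edge of \<open>T\<^sub>2\<close> is a bridge of \<open>T\<^sub>1 \<union> T\<^sub>2\<close>: extend the indicator of one side of the edge in
  \<open>T\<^sub>2\<close> to a potential on both graphs that is constant along all other edges. On \<open>V\<^sub>1\<close> it is determined
  by the roots; on the components of \<open>T\<^sub>2\<close> without element of \<open>S\<close> it is shifted to match.\<close>
lemma bridge_of_T2:
  assumes T1: "T1 \<in> rooted_forests V1 E1 g S" and e: "e \<in> T2"
  shows "\<not> conn g (T1 \<union> T2 - {e}) (fst (g e)) (snd (g e))"
proof
  let ?x = "fst (g e)" and ?y = "snd (g e)"
  assume con: "conn g (T1 \<union> T2 - {e}) ?x ?y"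
  define \<phi> :: "'v \<Rightarrow> int" where "\<phi> w = of_bool (conn g (T2 - {e}) ?x w)" for w
  define \<rho> where "\<rho> = root_of g S T1"
  define \<psi> where "\<psi> w = \<phi> w + (\<Sum>a | a \<in> P - S \<and> conn g T2 w a. \<phi> (\<rho> a) - \<phi> a)" for w
  have T1E: "T1 \<subseteq> E1" using T1 by (rule rooted_forestsD)
  \<comment> \<open>The two parts of the extension agree on the shared vertices: by
    \<open>classes\<close>, the sum in \<open>\<psi>\<close> is empty on \<open>S\<close> and has
    the single term \<open>b = a\<close> on the other terminals.\<close>
  have match: "\<psi> a = \<phi> (\<rho> a)" if a: "a \<in> P" for a
  proof (cases "a \<in> S")
    case True
    have rho: "\<rho> a = a"
      unfolding \<rho>_def using a P by (intro root_of_eq[OF T1 _ True]) auto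
    have empty: "{b. b \<in> P - S \<and> conn g T2 a b} = {}" using classes[OF a] True by blast
    show ?thesis unfolding \<psi>_def empty rho by simp
  next
    case False
    have single: "{b. b \<in> P - S \<and> conn g T2 a b} = {a}" using classes[OF a] False a by auto
    show ?thesis unfolding \<psi>_def single by simp
  qed
  have shift: "\<psi> x - \<phi> x = \<psi> y - \<phi> y" if "conn g T2 x y" for x y
    using conn_cong_left[OF that] by (simp add: \<psi>_def)
  have xy: "conn g T2 ?x ?y" using e by (rule conn_edge) simp
  have eV: "?x \<in> V2" "?y \<in> V2" using ends2[of e ?x ?y] e T2(1) by auto
  from con have "(?y \<in> V1 \<longrightarrow> \<phi> (\<rho> ?y) = \<psi> ?x) \<and> (?y \<in> V2 \<longrightarrow> \<psi> ?y = \<psi> ?x)"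
  proof (induction rule: conn_induct)
    case base
    then show ?case using match eV P by fastforce
  next
    case (step e' a b)
    show ?case
    proof (cases "e' \<in> T1")
      case True
      then have V: "a \<in> V1" "b \<in> V1" using ends1[OF _ step(2)] T1E by blast+
      have ab: "conn g T1 a b" using True step(2) by (rule conn_edge)
      have "\<rho> a = \<rho> b"
        unfolding \<rho>_def using root_of[OF T1 V(2)] conn_trans[OF ab]
        by (intro root_of_eq[OF T1 V(1)]) auto
      then show ?thesis using step(4) V match[of b] P by auto
    next
      case False
      then have eT: "e' \<in> T2 - {e}" using step(1) by blast
      then have V: "a \<in> V2" "b \<in> V2" using ends2[OF _ step(2)] T2(1) by blast+
      have ab: "conn g (T2 - {e}) a b" using eT step(2) by (rule conn_edge)
      have "\<phi> a = \<phi> b" using conn_cong_right[OF ab] by (simp add: \<phi>_def)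
      moreover have "conn g T2 a b" using ab by (rule conn_mono) auto
      ultimately have "\<psi> a = \<psi> b" using shift by fastforce
      then show ?thesis using step(4) V match[of b] P by auto
    qed
  qed
  \<comment> \<open>The shift is constant on components of \<open>T2\<close>, so equal values of
    \<open>\<psi>\<close> at the ends of \<open>e\<close> force equal values of
    \<open>\<phi>\<close>, although \<open>e\<close> is a bridge of \<open>T2\<close>.\<close>
  then have "\<phi> ?x = \<phi> ?y" using shift[OF xy] eV by simp
  then have "conn g (T2 - {e}) ?x ?y" by (simp add: \<phi>_def split: if_splits)
  then show False using T2(2) e by (simp add: forest_def)
qed

text \<open>Two elements of \<open>S\<close> joined in \<open>T1\<close> would close a cycle through
  \<open>T2\<close>. Conversely, a non-bridge of the union lying in \<open>T1\<close> could be
  deleted from \<open>T1\<close>, against minimality; edges of \<open>T2\<close> are bridges by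
  \<open>bridge_of_T2\<close>.\<close>

lemma rooted_forests_Un_iff:
  assumes T1: "T1 \<subseteq> E1" and r0: "r0 \<in> S"
  shows "T1 \<union> T2 \<in> rooted_forests (V1 \<union> V2) (E1 \<union> E2) g {r0} \<longleftrightarrow> T1 \<in> rooted_forests V1 E1 g S"
proof
  have fin: "finite T1" using T1 G1 by (auto simp: is_mgraph_def intro: finite_subset)
  let ?T = "T1 \<union> T2"
  {
    assume "?T \<in> rooted_forests (V1 \<union> V2) (E1 \<union> E2) g {r0}"
    then have f: "forest g ?T" and r: "rooted (V1 \<union> V2) g ?T {r0}"
      by (auto simp: rooted_forests_def)
    have f1: "forest g T1" using f by (rule forest_subset) auto
    have "separated g T1 S"
      unfolding separated_def
    proof (intro ballI impI, rule ccontr)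
      fix a b assume ab: "a \<in> S" "b \<in> S" "conn g T1 a b" "a \<noteq> b"
      from forest_separating_edge[OF f1 fin ab(3,4)] obtain e x y where
        e: "e \<in> T1" "g e = (x, y) \<or> g e = (y, x)" "conn g (T1 - {e}) a x" "conn g (T1 - {e}) y b" .
      have sub: "T1 - {e} \<subseteq> ?T - {e}" "T2 \<subseteq> ?T - {e}" using e(1) T1 T2(1) disj by auto
      have "conn g (?T - {e}) x y"
        using conn_trans[OF conn_trans[OF conn_mono[OF conn_sym[OF e(3)] sub(1)]
              conn_mono[OF S(2)[OF ab(1,2)] sub(2)]] conn_mono[OF conn_sym[OF e(4)] sub(1)]] .
      then show False using forest_bridge[OF f _ e(2)] e(1) by blast
    qed
    then show "T1 \<in> rooted_forests V1 E1 g S"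
      using T1 f1 r rooted_Un_iff[OF T1 r0] by (simp add: rooted_forests_def)
  }
  {
    assume T1S: "T1 \<in> rooted_forests V1 E1 g S"
    then have r1: "rooted V1 g T1 S" by (simp add: rooted_forests_def)
    then have r: "rooted (V1 \<union> V2) g ?T {r0}" using rooted_Un_iff[OF T1 r0] by simp
    have min: "\<not> rooted V1 g (T1 - {e}) S" if "e \<in> T1" for e
      using T1S that unfolding minimal_rooted_sets_eq[OF G1, symmetric] by blast
    have "forest g ?T"
      unfolding forest_def
    proof (intro ballI notI)
      fix e assume e: "e \<in> ?T" and c: "conn g (?T - {e}) (fst (g e)) (snd (g e))"
      show False
      proof (cases "e \<in> T1")
        case True
        then have "?T - {e} = (T1 - {e}) \<union> T2" using T1 T2(1) disj by blast
        moreover have "rooted (V1 \<union> V2) g (?T - {e}) {r0}"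
          using r conn_remove_nonbridge[OF c] unfolding rooted_def by blast
        ultimately have "rooted V1 g (T1 - {e}) S" using rooted_Un_iff[of "T1 - {e}" r0] T1 r0 by auto
        then show False using min[OF True] by blast
      next
        case False
        then show False using bridge_of_T2[OF T1S] e c by blast
      qed
    qed
    then show "?T \<in> rooted_forests (V1 \<union> V2) (E1 \<union> E2) g {r0}"
      using r T1 T2(1) by (auto simp: rooted_forests_def separated_def)
  }
qed

lemma card_extensions:
  assumes "S \<noteq> {}" "p \<in> V1 \<union> V2"
  shows "card {T1. T1 \<subseteq> E1 \<and> T1 \<union> T2 \<in> rooted_forests (V1 \<union> V2) (E1 \<union> E2) g {p}}
    = card (rooted_forests V1 E1 g S)"
proof -
  obtain r0 where r0: "r0 \<in> S" using assms(1) by blast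
  then have "r0 \<in> V1 \<union> V2" using S(1) P by blast
  \<comment> \<open>\<open>p\<close> may lie outside \<open>S\<close>, so the root is first moved to
    \<open>r0\<close>.\<close>
  from rooted_forests_singleton[OF assms(2) this] show ?thesis
    using rooted_forests_Un_iff[OF _ r0] rooted_forestsD(1)[of _ V1 E1 g S]
    by (metis (no_types, lifting) Collect_cong Collect_mem_eq)
qed

end

text \<open>A path from \<open>p\<close> enters \<open>V2\<close> through an edge of
  \<open>E1\<close> only at a terminal; from its last such entry on it stays in
  \<open>E2\<close>.\<close>

lemma rooted_part_of_glued:
  assumes G: "is_mgraph V1 E1 g" "is_mgraph V2 E2 g" and P: "V1 \<inter> V2 = P" "p \<in> P"
    and T: "T \<subseteq> E1 \<union> E2" "rooted (V1 \<union> V2) g T {p}"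
  shows "rooted V2 g (T \<inter> E2) P"
  unfolding rooted_def
proof
  fix v assume v: "v \<in> V2"
  then have "conn g T p v" using T(2) by (auto simp: rooted_def intro: conn_sym)
  then have "v \<in> V2 \<longrightarrow> (\<exists>a\<in>P. conn g (T \<inter> E2) v a)"
  proof (induction rule: conn_induct)
    case base
    then show ?case using P(2) conn_refl[of g "T \<inter> E2" p] by blast
  next
    case (step e x y)
    show ?case
    proof (cases "e \<in> E2")
      case True
      then have "x \<in> V2" using G(2) step(2) by (fastforce simp: is_mgraph_def)
      moreover have "conn g (T \<inter> E2) x y" using True step(1,2) by (intro conn_edge[of e]) auto
      ultimately show ?thesis using step(4) conn_cong_left[of g "T \<inter> E2" x y] by blast
    next
      case False
      then have "e \<in> E1" using step(1) T(1) by blast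
      then have "y \<in> V1" using G(1) step(2) by (fastforce simp: is_mgraph_def)
      then show ?thesis using P(1) conn_refl[of g "T \<inter> E2" y] by blast
    qed
  qed
  then show "\<exists>a\<in>P. conn g (T \<inter> E2) v a" using v by blast
qed

text \<open>Sort the trees by their restriction to \<open>E2\<close>, which lies in
  \<open>W\<close>. The number of completions depends only on the partition it induces on the
  terminals; the five partitions give the five summands.\<close>

lemma card_rooted_forests_Un:
  assumes G: "is_mgraph V1 E1 g" "is_mgraph V2 E2 g" and disj: "E1 \<inter> E2 = {}"
    and inter: "V1 \<inter> V2 = {p, q, s}" and dist: "p \<noteq> q" "p \<noteq> s" "q \<noteq> s"
  shows "card (rooted_forests (V1 \<union> V2) (E1 \<union> E2) g {p})
    = card (rooted_forests V1 E1 g {p}) * card (rooted_forests V2 E2 g {p, q, s})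
    + card (rooted_forests V1 E1 g {p, q, s}) * card (rooted_forests V2 E2 g {p})
    + card (rooted_forests V1 E1 g {p, q}) * card (split_forests V2 E2 g p q s)
    + card (rooted_forests V1 E1 g {p, s}) * card (split_forests V2 E2 g p s q)
    + card (rooted_forests V1 E1 g {q, s}) * card (split_forests V2 E2 g q s p)"
proof -
  let ?M = "rooted_forests (V1 \<union> V2) (E1 \<union> E2) g {p}" and ?P = "{p, q, s}"
  let ?N = "\<lambda>S. card (rooted_forests V1 E1 g S)"
  define W where "W = {T. T \<subseteq> E2 \<and> forest g T \<and> rooted V2 g T ?P}"
  define F where "F T2 = {T1. T1 \<subseteq> E1 \<and> T1 \<union> T2 \<in> ?M}" for T2
  have fin: "finite E1" "finite E2" using G by (auto simp: is_mgraph_def)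
  have finW: "finite W" and finF: "finite (F T2)" for T2
    using fin by (auto simp: W_def F_def)
  have VP: "p \<in> V2" "q \<in> V2" "s \<in> V2" "p \<in> V1 \<union> V2" using inter by blast+
  let ?h = "\<lambda>T. (T \<inter> E2, T \<inter> E1)"
  have "bij_betw ?h ?M (Sigma W F)"
  proof (rule bij_betw_byWitness[where f' = "\<lambda>(T2, T1). T1 \<union> T2"])
    have decomp: "(T \<inter> E1) \<union> (T \<inter> E2) = T" if "T \<in> ?M" for T
      using rooted_forestsD(1)[OF that] by blast
    then show "\<forall>T\<in>?M. (case ?h T of (T2, T1) \<Rightarrow> T1 \<union> T2) = T" by simp
    show "\<forall>x\<in>Sigma W F. ?h (case x of (T2, T1) \<Rightarrow> T1 \<union> T2) = x"
      using disj by (auto simp: W_def F_def)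
    show "?h ` ?M \<subseteq> Sigma W F"
    proof (intro image_subsetI SigmaI)
      fix T assume T: "T \<in> ?M"
      note D = rooted_forestsD[OF T]
      have "rooted V2 g (T \<inter> E2) ?P"
        using T by (intro rooted_part_of_glued[OF G inter _ D(1), of p]) (auto simp: rooted_forests_def)
      then show "T \<inter> E2 \<in> W" using forest_subset[OF D(2), of "T \<inter> E2"] by (simp add: W_def)
      show "T \<inter> E1 \<in> F (T \<inter> E2)" using decomp[OF T] T by (simp add: F_def)
    qed
    show "(\<lambda>(T2, T1). T1 \<union> T2) ` Sigma W F \<subseteq> ?M" by (auto simp: F_def)
  qed
  then have "card ?M = (\<Sum>T2\<in>W. card (F T2))"
    using finW finF by (simp add: bij_betw_same_card)
  also have "\<dots> = (\<Sum>T2\<in>W. ?N {p} * of_bool (T2 \<in> rooted_forests V2 E2 g ?P)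
     + ?N ?P * of_bool (T2 \<in> rooted_forests V2 E2 g {p})
     + ?N {p, q} * of_bool (T2 \<in> split_forests V2 E2 g p q s)
     + ?N {p, s} * of_bool (T2 \<in> split_forests V2 E2 g p s q)
     + ?N {q, s} * of_bool (T2 \<in> split_forests V2 E2 g q s p))"
  proof (rule sum.cong[OF refl])
    fix T2 assume T2: "T2 \<in> W"
    let ?c = "conn g T2"
    have sym: "?c q p = ?c p q" "?c s p = ?c p s" "?c s q = ?c q s" by (rule conn_commute)+
    have trans: "?c p q \<Longrightarrow> ?c p s = ?c q s" "?c p s \<Longrightarrow> ?c p q = ?c q s" "?c q s \<Longrightarrow> ?c p q = ?c p s"
      using conn_cong_left[of g T2 p q s] conn_cong_left[of g T2 p s q] conn_cong_right[of g T2 q s p] sym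
      by blast+
    \<comment> \<open>In \<open>T2\<close> every vertex of \<open>V2\<close> reaches a terminal, so
      rootedness need only be tested there; membership then depends on three connections.\<close>
    have root: "rooted V2 g T2 S \<longleftrightarrow> (\<forall>a\<in>?P. \<exists>r\<in>S. ?c a r)" for S
    proof
      assume "rooted V2 g T2 S"
      then show "\<forall>a\<in>?P. \<exists>r\<in>S. ?c a r" using VP by (simp add: rooted_def)
    next
      assume R: "\<forall>a\<in>?P. \<exists>r\<in>S. ?c a r"
      show "rooted V2 g T2 S"
        unfolding rooted_def
      proof
        fix v assume "v \<in> V2"
        then obtain a where a: "a \<in> ?P" "?c v a" using T2 unfolding W_def rooted_def by blast
        show "\<exists>r\<in>S. ?c v r" using R a(1) conn_cong_left[OF a(2)] by blast
      qed
    qed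
    have mem: "T2 \<in> rooted_forests V2 E2 g ?P \<longleftrightarrow> \<not> ?c p q \<and> \<not> ?c p s \<and> \<not> ?c q s"
      "T2 \<in> rooted_forests V2 E2 g {p} \<longleftrightarrow> ?c p q \<and> ?c p s"
      "T2 \<in> split_forests V2 E2 g p q s \<longleftrightarrow> ?c p q \<and> \<not> ?c p s"
      "T2 \<in> split_forests V2 E2 g p s q \<longleftrightarrow> ?c p s \<and> \<not> ?c p q"
      "T2 \<in> split_forests V2 E2 g q s p \<longleftrightarrow> ?c q s \<and> \<not> ?c p q"
      using T2 dist unfolding W_def rooted_forests_def split_forests_def
      by (auto simp: root separated_def sym)
    \<comment> \<open>\<open>S\<close> is the class with several terminals; if all classes are
      singletons, any of them serves, and \<open>{p}\<close> is taken.\<close>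
    have ext: "card (F T2) = ?N S"
      if "S \<noteq> {}" "S \<subseteq> ?P" "\<forall>a\<in>S. \<forall>b\<in>S. ?c a b"
        "\<forall>a\<in>?P. \<forall>b\<in>?P. ?c a b \<longrightarrow> a = b \<or> a \<in> S \<and> b \<in> S" for S
    proof -
      interpret gluing V1 V2 ?P S E1 E2 T2 g
        using G disj inter T2 that by unfold_locales (auto simp: W_def)
      show ?thesis unfolding F_def by (rule card_extensions[OF that(1) VP(4)])
    qed
    consider "\<not> ?c p q" "\<not> ?c p s" "\<not> ?c q s" | "?c p q" "?c p s" "?c q s"
      | "?c p q" "\<not> ?c p s" "\<not> ?c q s" | "\<not> ?c p q" "?c p s" "\<not> ?c q s"
      | "\<not> ?c p q" "\<not> ?c p s" "?c q s"
      using trans by blast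
    then show "card (F T2) = ?N {p} * of_bool (T2 \<in> rooted_forests V2 E2 g ?P)
     + ?N ?P * of_bool (T2 \<in> rooted_forests V2 E2 g {p})
     + ?N {p, q} * of_bool (T2 \<in> split_forests V2 E2 g p q s)
     + ?N {p, s} * of_bool (T2 \<in> split_forests V2 E2 g p s q)
     + ?N {q, s} * of_bool (T2 \<in> split_forests V2 E2 g q s p)"
    proof cases
      case 1
      then show ?thesis using ext[of "{p}"] by (simp add: mem sym)
    next
      case 2
      then show ?thesis using ext[of ?P] by (simp add: mem sym)
    next
      case 3
      then show ?thesis using ext[of "{p, q}"] by (simp add: mem sym)
    next
      case 4
      then show ?thesis using ext[of "{p, s}"] by (simp add: mem sym)
    next
      case 5
      then show ?thesis using ext[of "{q, s}"] by (simp add: mem sym)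
    qed
  qed
  also have "\<dots> = ?N {p} * card (rooted_forests V2 E2 g ?P)
     + ?N ?P * card (rooted_forests V2 E2 g {p})
     + ?N {p, q} * card (split_forests V2 E2 g p q s)
     + ?N {p, s} * card (split_forests V2 E2 g p s q)
     + ?N {q, s} * card (split_forests V2 E2 g q s p)"
  proof -
    have cnt: "(\<Sum>T\<in>W. k * of_bool (T \<in> C)) = k * card C" if "C \<subseteq> W" for C and k :: nat
    proof -
      have "W \<inter> C = C" using that by blast
      then show ?thesis using finW by (simp add: sum_distrib_left[symmetric] sum_of_bool_eq Int_def)
    qed
    have "rooted V2 g T ?P" if "rooted V2 g T S" "S \<subseteq> ?P" for T S
      using that unfolding rooted_def by blast
    then have sub: "rooted_forests V2 E2 g S \<subseteq> W" if "S \<subseteq> ?P" for S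
      using that unfolding rooted_forests_def W_def by blast
    have sub2: "split_forests V2 E2 g a b c \<subseteq> W" if "a \<in> ?P" "c \<in> ?P" for a b c
      using that unfolding split_forests_def W_def rooted_def by blast
    show ?thesis
      unfolding sum.distrib by (simp add: cnt sub sub2)
  qed
  finally show ?thesis .
qed

section \<open>Invariance under isomorphism\<close>

lemma conn_iso_imp:
  assumes "inj_on \<phi> V" "is_mgraph V E g" "T \<subseteq> E"
    and ends: "\<And>e. e \<in> E \<Longrightarrow> h (\<psi> e) = map_prod \<phi> \<phi> (g e) \<or> h (\<psi> e) = prod.swap (map_prod \<phi> \<phi> (g e))"
    and c: "conn h (\<psi> ` T) (\<phi> u) (\<phi> v)" and V: "u \<in> V" "v \<in> V"
  shows "conn g T u v"
proof -
  \<comment> \<open>Vertices on the path in \<open>h\<close> are known only as images, so the claim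
    is stated for preimages in \<open>V\<close>; injectivity makes them unique.\<close>
  from c have "\<forall>w\<in>V. \<phi> w = \<phi> v \<longrightarrow> conn g T u w"
  proof (induction rule: conn_induct)
    case base
    then show ?case using inj_on_eq_iff[OF assms(1) _ V(1)] by simp
  next
    case (step e' x y)
    then obtain e where e: "e \<in> T" "e' = \<psi> e" by blast
    then have eE: "e \<in> E" using assms(3) by blast
    obtain a0 b0 where g: "g e = (a0, b0)" by fastforce
    then have "x = \<phi> a0 \<and> y = \<phi> b0 \<or> x = \<phi> b0 \<and> y = \<phi> a0"
      using ends[OF eE] step(2) e(2) by auto
    then obtain a b where ab: "g e = (a, b) \<or> g e = (b, a)" "x = \<phi> a" "y = \<phi> b"
      using g by blast
    have abV: "a \<in> V" "b \<in> V" using assms(2) eE ab(1) by (auto simp: is_mgraph_def)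
    have edge: "conn g T a b" using e(1) ab(1) by (rule conn_edge)
    have "conn g T u a" using step(4) abV(1) ab(2) by blast
    then have "conn g T u b" using edge by (rule conn_trans)
    then show ?case using inj_on_eq_iff[OF assms(1) _ abV(2)] ab(3) by simp
  qed
  then show ?thesis using V(2) by blast
qed

lemma conn_iso_iff:
  assumes "inj_on \<phi> V" "is_mgraph V E g" "T \<subseteq> E"
    and ends: "\<And>e. e \<in> E \<Longrightarrow> h (\<psi> e) = map_prod \<phi> \<phi> (g e) \<or> h (\<psi> e) = prod.swap (map_prod \<phi> \<phi> (g e))"
    and V: "u \<in> V" "v \<in> V"
  shows "conn h (\<psi> ` T) (\<phi> u) (\<phi> v) \<longleftrightarrow> conn g T u v"
proof
  assume "conn h (\<psi> ` T) (\<phi> u) (\<phi> v)"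
  from conn_iso_imp[OF assms(1-3) ends this V] show "conn g T u v" .
next
  assume "conn g T u v"
  then show "conn h (\<psi> ` T) (\<phi> u) (\<phi> v)"
  proof (induction rule: conn_induct)
    case base
    show ?case by simp
  next
    case (step e x y)
    have "h (\<psi> e) = (\<phi> x, \<phi> y) \<or> h (\<psi> e) = (\<phi> y, \<phi> x)"
      using ends[of e] step(1,2) assms(3) by auto
    then have "conn h (\<psi> ` T) (\<phi> x) (\<phi> y)" using step(1) by (intro conn_edge[of "\<psi> e"]) auto
    with step(4) show ?case by (rule conn_trans)
  qed
qed

text \<open>Taking images under \<open>\<psi>\<close> is a bijection of the forests because
  connections are transported both ways; reversed endpoints are harmless, as \<open>conn\<close> is
  symmetric.\<close>

lemma card_rooted_forests_iso:
  assumes \<phi>: "bij_betw \<phi> V V'" and \<psi>: "bij_betw \<psi> E E'" and G: "is_mgraph V E g" and S: "S \<subseteq> V"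
    and ends: "\<And>e. e \<in> E \<Longrightarrow> h (\<psi> e) = map_prod \<phi> \<phi> (g e) \<or> h (\<psi> e) = prod.swap (map_prod \<phi> \<phi> (g e))"
  shows "card (rooted_forests V' E' h (\<phi> ` S)) = card (rooted_forests V E g S)"
proof -
  have inj: "inj_on \<phi> V" "inj_on \<psi> E" and im: "\<phi> ` V = V'" "\<psi> ` E = E'"
    using \<phi> \<psi> by (auto simp: bij_betw_def)
  have C: "conn h (\<psi> ` T) (\<phi> u) (\<phi> v) \<longleftrightarrow> conn g T u v" if "T \<subseteq> E" "u \<in> V" "v \<in> V" for T u v
    using conn_iso_iff[where h = h and \<psi> = \<psi>, OF inj(1) G that(1) ends that(2,3)] .
  have iff: "\<psi> ` T \<in> rooted_forests V' E' h (\<phi> ` S) \<longleftrightarrow> T \<in> rooted_forests V E g S"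
    if T: "T \<subseteq> E" for T
  proof -
    have "\<not> conn h (\<psi> ` T - {\<psi> e}) (fst (h (\<psi> e))) (snd (h (\<psi> e)))
        \<longleftrightarrow> \<not> conn g (T - {e}) (fst (g e)) (snd (g e))" if e: "e \<in> T" for e
    proof -
      have eE: "e \<in> E" using e T by blast
      have "\<psi> ` T - {\<psi> e} = \<psi> ` (T - {e})"
        using inj_on_image_set_diff[OF inj(2), of T "{e}"] T e by auto
      moreover have "fst (g e) \<in> V" "snd (g e) \<in> V" using G eE by (auto simp: is_mgraph_def)
      moreover have "T - {e} \<subseteq> E" using T by blast
      ultimately show ?thesis
        using ends[OF eE] C[of "T - {e}" "fst (g e)" "snd (g e)"]
          conn_commute[of h _ "\<phi> (fst (g e))"] by (cases "g e") auto
    qed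
    then have "forest h (\<psi> ` T) \<longleftrightarrow> forest g T" by (simp add: forest_def)
    moreover have "rooted V' h (\<psi> ` T) (\<phi> ` S) \<longleftrightarrow> rooted V g T S"
      unfolding rooted_def im(1)[symmetric] using C[OF T] S by (auto simp: subset_iff)
    moreover have "separated h (\<psi> ` T) (\<phi> ` S) \<longleftrightarrow> separated g T S"
      unfolding separated_def using C[OF T] S inj_on_eq_iff[OF inj(1)] by (auto simp: subset_iff)
    moreover have "\<psi> ` T \<subseteq> E'" using T im(2) by blast
    ultimately show ?thesis using T by (simp add: rooted_forests_def)
  qed
  have "rooted_forests V' E' h (\<phi> ` S) = image \<psi> ` rooted_forests V E g S"
  proof (intro equalityI subsetI)
    fix T' assume T': "T' \<in> rooted_forests V' E' h (\<phi> ` S)"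
    then have "T' \<subseteq> \<psi> ` E" using im(2) rooted_forestsD(1) by blast
    then obtain T where "T \<subseteq> E" "T' = \<psi> ` T" by (rule subset_imageE)
    then show "T' \<in> image \<psi> ` rooted_forests V E g S" using iff T' by blast
  next
    fix T' assume "T' \<in> image \<psi> ` rooted_forests V E g S"
    then show "T' \<in> rooted_forests V' E' h (\<phi> ` S)"
      using iff rooted_forestsD(1)[of _ V E g S] by blast
  qed
  moreover have "inj_on (image \<psi>) (rooted_forests V E g S)"
    by (rule inj_on_subset[OF inj_on_image_Pow[OF inj(2)]]) (auto simp: rooted_forests_def)
  ultimately show ?thesis by (simp add: card_image)
qed

section \<open>Assembling the gluing formula and the case of two copies\<close>

theorem theorem5p4:
  fixes V1 V2 :: "'v set" and E1 E2 :: "'e set" and ends :: "'e \<Rightarrow> 'v \<times> 'v"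
    and p q s :: 'v
  assumes g1: "is_mgraph V1 E1 ends" and g2: "is_mgraph V2 E2 ends"
    and c1: "connected_sub V1 E1 ends" and c2: "connected_sub V2 E2 ends"
    and cG: "connected_sub (V1 \<union> V2) (E1 \<union> E2) ends"
    and disj: "E1 \<inter> E2 = {}"
    and inter: "V1 \<inter> V2 = {p, q, s}"
    and dist: "p \<noteq> q" "p \<noteq> s" "q \<noteq> s"
  shows "real (num_st (V1 \<union> V2) (E1 \<union> E2) ends) =
           real (num_st V1 E1 ends) * real (num_st_ident V2 E2 ends {p, q, s})
         + real (num_st V2 E2 ends) * real (num_st_ident V1 E1 ends {p, q, s})
         + (1/2) * (  real (num_st_ident V1 E1 ends {p, s}) *
                        (- real (num_st_ident V2 E2 ends {p, s}) + real (num_st_ident V2 E2 ends {p, q})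
                         + real (num_st_ident V2 E2 ends {q, s}))
                    + real (num_st_ident V1 E1 ends {p, q}) *
                        (real (num_st_ident V2 E2 ends {p, s}) - real (num_st_ident V2 E2 ends {p, q})
                         + real (num_st_ident V2 E2 ends {q, s}))
                    + real (num_st_ident V1 E1 ends {q, s}) *
                        (real (num_st_ident V2 E2 ends {p, s}) + real (num_st_ident V2 E2 ends {p, q})
                         - real (num_st_ident V2 E2 ends {q, s})))
       \<and> ((\<exists>\<phi> \<psi>. bij_betw \<phi> V1 V2 \<and> \<phi> p = p \<and> \<phi> q = q \<and> \<phi> s = s \<and> bij_betw \<psi> E1 E2 \<and>
              (\<forall>e\<in>E1. ends (\<psi> e) = map_prod \<phi> \<phi> (ends e)
                      \<or> ends (\<psi> e) = prod.swap (map_prod \<phi> \<phi> (ends e))))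
          \<longrightarrow> num_st (V1 \<union> V2) (E1 \<union> E2) ends
                = 4 * num_st V1 E1 ends * num_st_ident V1 E1 ends {p, q, s})"
proof -
  let "?A \<and> ?B" = ?thesis
  let ?C1 = "\<lambda>S. card (rooted_forests V1 E1 ends S)" and ?C2 = "\<lambda>S. card (rooted_forests V2 E2 ends S)"
  have V1: "p \<in> V1" "q \<in> V1" "s \<in> V1" and V2: "p \<in> V2" "q \<in> V2" "s \<in> V2" using inter by blast+
  have G: "is_mgraph (V1 \<union> V2) (E1 \<union> E2) ends" using g1 g2 by (auto simp: is_mgraph_def)
  have fin: "finite E1" "finite E2" using g1 g2 by (auto simp: is_mgraph_def)
  have t: "num_st (V1 \<union> V2) (E1 \<union> E2) ends = card (rooted_forests (V1 \<union> V2) (E1 \<union> E2) ends {p})"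
    using num_st_eq[OF G] V1 by blast
  have t1: "num_st V1 E1 ends = ?C1 {p}" and t2: "num_st V2 E2 ends = ?C2 {p}"
    using num_st_eq[OF g1 V1(1)] num_st_eq[OF g2 V2(1)] by simp_all
  have i1: "num_st_ident V1 E1 ends S = ?C1 S" and i2: "num_st_ident V2 E2 ends S = ?C2 S"
    if "S \<noteq> {}" "S \<subseteq> {p, q, s}" for S
    using num_st_ident_eq[OF g1 that(1)] num_st_ident_eq[OF g2 that(1)] that(2) inter by auto
  have pairs: "card (rooted_forests V E ends {p, s})
      = card (split_forests V E ends p q s) + card (split_forests V E ends q s p)"
    "card (rooted_forests V E ends {p, q})
      = card (split_forests V E ends p s q) + card (split_forests V E ends q s p)"
    "card (rooted_forests V E ends {q, s})
      = card (split_forests V E ends p q s) + card (split_forests V E ends p s q)"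
    if "finite E" "p \<in> V" "q \<in> V" "s \<in> V" for V and E :: "'e set"
    using card_rooted_forests_pair[OF that(1) dist(2) that(3)]
      card_rooted_forests_pair[OF that(1) dist(1) that(4)]
      card_rooted_forests_pair[OF that(1) dist(3) that(2)]
      split_forests_commute[of V E ends s q p] split_forests_commute[of V E ends q p s]
      split_forests_commute[of V E ends s p q]
    by simp_all
  note pairs1 = pairs[OF fin(1) V1] and pairs2 = pairs[OF fin(2) V2]
  note glue = card_rooted_forests_Un[OF g1 g2 disj inter dist]
  \<comment> \<open>In split counts, the combination with a minus sign at \<open>{p, s}\<close> is
    twice the number of forests splitting off \<open>q\<close>, and likewise for the other two; this
    cancels the factor 1/2.\<close>
  have A: ?A
    by (simp add: t t1 t2 i1 i2 glue pairs1 pairs2 field_simps)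
  have B: ?B
  proof (intro impI, elim exE conjE)
    fix \<phi> \<psi>
    assume iso: "bij_betw \<phi> V1 V2" "\<phi> p = p" "\<phi> q = q" "\<phi> s = s" "bij_betw \<psi> E1 E2"
      "\<forall>e\<in>E1. ends (\<psi> e) = map_prod \<phi> \<phi> (ends e) \<or> ends (\<psi> e) = prod.swap (map_prod \<phi> \<phi> (ends e))"
    have same: "?C2 S = ?C1 S" if "S \<subseteq> {p, q, s}" for S
    proof -
      have "\<phi> ` S = S" using that iso(2-4) by force
      moreover have "S \<subseteq> V1" using that V1 by blast
      ultimately show ?thesis
        using card_rooted_forests_iso[OF iso(1,5) g1, of S ends] iso(6) by simp
    qed
    note id = three_terminal_identity[OF g1 V1 dist]
    have ps: "?C1 {s} = ?C1 {p}" using rooted_forests_singleton[OF V1(3,1)] by metis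
    \<comment> \<open>The isomorphism is applied to pair-rooted forests only; the split counts then
      agree because the three pair relations determine them.\<close>
    have eq: "card (split_forests V2 E2 ends p q s) = card (split_forests V1 E1 ends p q s)"
      "card (split_forests V2 E2 ends p s q) = card (split_forests V1 E1 ends p s q)"
      "card (split_forests V2 E2 ends q s p) = card (split_forests V1 E1 ends q s p)"
      using pairs1 pairs2 same[of "{p, s}"] same[of "{p, q}"] same[of "{q, s}"] by simp_all
    \<comment> \<open>For equal halves the three mixed terms add up to twice the right side of
      \<open>id\<close>, hence to two further copies of the product.\<close>
    have "real (num_st (V1 \<union> V2) (E1 \<union> E2) ends) = 4 * (real (?C1 {p}) * real (?C1 {p, q, s}))"
      using id unfolding t glue eq by (simp add: ps same pairs1 algebra_simps)
    then have "real (num_st (V1 \<union> V2) (E1 \<union> E2) ends)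
        = real (4 * num_st V1 E1 ends * num_st_ident V1 E1 ends {p, q, s})"
      by (simp add: t1 i1)
    then show "num_st (V1 \<union> V2) (E1 \<union> E2) ends
        = 4 * num_st V1 E1 ends * num_st_ident V1 E1 ends {p, q, s}"
      by (simp only: of_nat_eq_iff)
  qed
  from A B show ?thesis ..
qed

end
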